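(* Let $\mathcal{A}$ be a finite alphabet with $|\mathcal{A}|\ge 2$, let $n\ge 1$, $0\le r\le n$ and $1\le m\le |\mathcal{A}|^n$ be integers. Let $\mathcal{S}$ be drawn uniformly at random from all subsets of $\mathcal{A}^n$ containing exactly $m$ words, and let $\mu$ be the uniform distribution on $\mathcal{S}$. Suppose that the random erasure function $e$ erases exactly $r$ symbols of its argument (leaving the other symbols unchanged), the set of erased positions being drawn uniformly among the $r$-element subsets of $\{1,\dots,n\}$, independently of $\mathcal{S}$ (and of the word to which $e$ is applied). Let $f^*=f^*_{\mathcal{S}}$ be the retrieval rule of a maximum likelihood associative memory for $\mathcal{S}$, i.e. a maximizer of the success probability $P_{\mathcal{S}}(f)$ over all mappings $f:\overline{\mathcal{A}}^n\to\mathcal{S}$. Then $$\mathbb{E}\left[P_{\mathcal{S}}(f^* )\right]=\frac{|\mathcal{A}|^{n-r}}{m}\left(1-\frac{\binom{|\mathcal{A}|^n-m}{|\mathcal{A}|^r}}{\binom{|\mathcal{A}|^n}{|\mathcal{A}|^r}}\right),$$ where the expectation is taken with respect to the random set $\mathcal{S}$.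
   Context: Let $\overline{\mathcal{A}}=\mathcal{A}\sqcup\{\bot\}$, where $\bot$ denotes an erased symbol. For a set $\mathcal{S}\subset\mathcal{A}^n$ of $m$ words with a probability measure $\mu$ on $\mathcal{S}$, and a random function $e:\mathcal{S}\to\overline{\mathcal{A}}^n$ (the erasure function), a retrieval rule is a mapping $f:\overline{\mathcal{A}}^n\to\mathcal{S}$. Its success probability is $$P_{\mathcal{S}}(f)=\sum_{w\in\mathcal{S}}\mu(w)\,P\big(f(e(w))=w\big),$$ where the probability $P$ is with respect to the randomness of $e$. A maximum likelihood associative memory is an algorithm which, given $\mathcal{S}$, returns a mapping $f^*$ maximizing $P_{\mathcal{S}}(f)$ over all mappings $f:\overline{\mathcal{A}}^n\to\mathcal{S}$. Convention: $\binom{a}{b}=0$ if $b>a\ge 0$. *)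

theory Defs
  imports "HOL-Probability.Probability"
begin

definition words :: "'a set \<Rightarrow> nat \<Rightarrow> 'a list set" where
  "words A n = {w. set w \<subseteq> A \<and> length w = n}"

text \<open>The erased symbol is \<open>None\<close>; an unerased symbol \<open>a\<close> becomes \<open>Some a\<close>.\<close>

definition with_erasure :: "'a set \<Rightarrow> 'a option set" where
  "with_erasure A = insert None (Some ` A)"

text \<open>Positions are numbered from 0, so that \<open>{1, \<dots>, n}\<close> becomes \<open>{..<n}\<close>.\<close>

definition erase :: "nat set \<Rightarrow> 'a list \<Rightarrow> 'a option list" where
  "erase R w = map (\<lambda>i. if i \<in> R then None else Some (w ! i)) [0..<length w]"

definition subsets_of_card :: "'a set \<Rightarrow> nat \<Rightarrow> 'a set set" where
  "subsets_of_card X k = {Y. Y \<subseteq> X \<and> card Y = k}"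

text \<open>The random erasure function is given by its law \<open>E\<close>, a distribution on functions.\<close>

definition success_prob ::
  "'a list set \<Rightarrow> 'a list pmf \<Rightarrow> ('a list \<Rightarrow> 'a option list) pmf
    \<Rightarrow> ('a option list \<Rightarrow> 'a list) \<Rightarrow> real" where
  "success_prob S \<mu> E f =
    (\<Sum>w\<in>S. pmf \<mu> w * measure_pmf.prob E {e. f (e w) = w})"

definition retrieval_rules ::
  "'a set \<Rightarrow> nat \<Rightarrow> 'a list set \<Rightarrow> ('a option list \<Rightarrow> 'a list) set" where
  "retrieval_rules A n S = words (with_erasure A) n \<rightarrow> S"

definition max_likelihood_rule ::
  "'a set \<Rightarrow> nat \<Rightarrow> 'a list set \<Rightarrow> 'a list pmf \<Rightarrow> ('a list \<Rightarrow> 'a option list) pmf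
    \<Rightarrow> ('a option list \<Rightarrow> 'a list) \<Rightarrow> bool" where
  "max_likelihood_rule A n S \<mu> E f \<longleftrightarrow>
    is_arg_max (success_prob S \<mu> E) (\<lambda>g. g \<in> retrieval_rules A n S) f"

text \<open>
  For every word, the set of erased positions is uniform among the \<open>r\<close>-element sets of positions.
  The joint behaviour on several words is left open: one set of positions may be shared by
  all words, or the sets may be drawn separately for each word.
\<close>

definition uniform_erasure ::
  "'a set \<Rightarrow> nat \<Rightarrow> nat \<Rightarrow> ('a list \<Rightarrow> 'a option list) pmf \<Rightarrow> bool" where
  "uniform_erasure A n r E \<longleftrightarrow>
    (\<forall>w\<in>words A n. map_pmf (\<lambda>e. e w) E =
       map_pmf (\<lambda>R. erase R w) (pmf_of_set (subsets_of_card {..<n} r)))"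

lemma uniform_erasure_shared:
  "uniform_erasure A n r (map_pmf erase (pmf_of_set (subsets_of_card {..<n} r)))"
  by (simp add: uniform_erasure_def map_pmf_comp)

end

theory Submission
  imports Defs
begin

text \<open>
  For a fixed set \<open>R\<close> of erased positions, a retrieval rule recovers at most one word of \<open>S\<close> from
  each of the erased words in \<open>erase R ` S\<close>. Since \<open>R\<close> can be read off an erased word, one rule
  attains this bound for all \<open>R\<close> at once, so the optimal success probability is the mean over \<open>R\<close>
  of \<open>card (erase R ` S) / m\<close>. The map \<open>erase R\<close> on \<open>words A n\<close> has \<open>card A ^ (n - r)\<close> fibres,
  each with \<open>card A ^ r\<close> elements, so averaging over \<open>S\<close> reduces to the probability that a random
  \<open>S\<close> avoids a fixed fibre.
\<close>

section \<open>Cardinalities of sets of words and of families of subsets\<close>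

lemma finite_subsets_of_card: "finite X \<Longrightarrow> finite (subsets_of_card X k)"
  unfolding subsets_of_card_def by (rule finite_subset[of _ "Pow X"]) auto

lemma card_subsets_of_card: "finite X \<Longrightarrow> card (subsets_of_card X k) = card X choose k"
  unfolding subsets_of_card_def by (rule n_subsets)

lemma subsets_of_card_nonempty:
  assumes "finite X" "k \<le> card X"
  shows "subsets_of_card X k \<noteq> {}"
  using card_subsets_of_card[OF assms(1), of k] assms(2)
  by (metis binomial_eq_0_iff card.empty not_le)

lemma finite_words: "finite A \<Longrightarrow> finite (words A n)"
  unfolding words_def by (rule finite_lists_length_eq)

lemma card_words: "finite A \<Longrightarrow> card (words A n) = card A ^ n"
  unfolding words_def by (rule card_lists_length_eq)

section \<open>The erasure map for a fixed set of positions, and its fibres\<close>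

lemma length_erase [simp]: "length (erase R w) = length w"
  by (simp add: erase_def)

lemma nth_erase [simp]:
  "i < length w \<Longrightarrow> erase R w ! i = (if i \<in> R then None else Some (w ! i))"
  by (simp add: erase_def)

lemma erase_eq_iff:
  assumes "length w = n" "length w' = n"
  shows "erase R w = erase R w' \<longleftrightarrow> (\<forall>i<n. i \<notin> R \<longrightarrow> w ! i = w' ! i)"
  using assms by (auto simp: list_eq_iff_nth_eq)

lemma erased_positions_erase:
  assumes "R \<subseteq> {..<length w}"
  shows "{i. i < length (erase R w) \<and> erase R w ! i = None} = R"
  using assms by (auto split: if_splits)

text \<open>A word in the fibre of \<open>w0\<close> agrees with \<open>w0\<close> off
  \<open>R\<close> and is arbitrary on \<open>R\<close>, so restriction to \<open>R\<close>
  identifies the fibre with the functions from \<open>R\<close> to \<open>A\<close>. The inverse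
  \<open>?g\<close> takes the positions outside \<open>R\<close> from \<open>w0\<close>.\<close>

lemma card_erase_fibre:
  assumes "finite A" "R \<subseteq> {..<n}" "w0 \<in> words A n"
  shows "card {w \<in> words A n. erase R w = erase R w0} = card A ^ card R"
proof -
  let ?F = "{w \<in> words A n. erase R w = erase R w0}"
  let ?g = "\<lambda>h. map (\<lambda>i. if i \<in> R then h i else w0 ! i) [0..<n]"
  have len: "length w0 = n" and w0: "\<And>i. i < n \<Longrightarrow> w0 ! i \<in> A"
    using assms(3) by (auto simp: words_def)
  have "bij_betw (\<lambda>w. restrict ((!) w) R) ?F (R \<rightarrow>\<^sub>E A)"
  proof (rule bij_betw_byWitness[where f' = ?g])
    show "\<forall>w\<in>?F. ?g (restrict ((!) w) R) = w"
    proof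
      fix w assume w: "w \<in> ?F"
      then have "length w = n" by (simp add: words_def)
      with w show "?g (restrict ((!) w) R) = w"
        using erase_eq_iff[OF _ len, of w R] by (auto intro!: nth_equalityI)
    qed
    show "\<forall>h\<in>R \<rightarrow>\<^sub>E A. restrict ((!) (?g h)) R = h"
    proof
      fix h assume "h \<in> R \<rightarrow>\<^sub>E A"
      then show "restrict ((!) (?g h)) R = h"
        using assms(2) by (intro ext) (auto simp: PiE_def extensional_def)
    qed
    show "(\<lambda>w. restrict ((!) w) R) ` ?F \<subseteq> R \<rightarrow>\<^sub>E A"
      using assms(2) by (fastforce simp: words_def)
    show "?g ` (R \<rightarrow>\<^sub>E A) \<subseteq> ?F"
    proof (rule image_subsetI)
      fix h assume h: "h \<in> R \<rightarrow>\<^sub>E A"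
      have "?g h \<in> words A n"
        using h w0 by (auto simp: words_def)
      moreover have "erase R (?g h) = erase R w0"
        using erase_eq_iff[OF _ len, of "?g h" R] by simp
      ultimately show "?g h \<in> ?F" by simp
    qed
  qed
  then have "card ?F = card (R \<rightarrow>\<^sub>E A)"
    by (rule bij_betw_same_card)
  also have "\<dots> = card A ^ card R"
    using finite_subset[OF assms(2)] by (simp add: card_PiE)
  finally show ?thesis .
qed

lemma card_eq_card_image_times_fibre:
  assumes "finite X" "\<And>x. x \<in> X \<Longrightarrow> card {y \<in> X. g y = g x} = k"
  shows "card X = card (g ` X) * k"
proof -
  have "card X = (\<Sum>v\<in>g ` X. \<Sum>y\<in>{y \<in> X. g y = v}. 1)"
    using sum.image_gen[OF assms(1), of "\<lambda>_. 1::nat" g] by simp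
  also have "\<dots> = (\<Sum>v\<in>g ` X. k)"
    using assms(2) by (intro sum.cong) auto
  finally show ?thesis by simp
qed

lemma card_erase_image:
  assumes "finite A" "A \<noteq> {}" "R \<subseteq> {..<n}"
  shows "card (erase R ` words A n) = card A ^ (n - card R)"
proof -
  have "card A ^ n = card (erase R ` words A n) * card A ^ card R"
    using card_eq_card_image_times_fibre[OF finite_words[OF assms(1)], of n "erase R"]
      card_erase_fibre[OF assms(1,3)] card_words[OF assms(1)] by metis
  moreover have "card R \<le> n"
    using card_mono[OF _ assms(3)] by simp
  then have "card A ^ n = card A ^ (n - card R) * card A ^ card R"
    by (simp flip: power_add)
  \<comment> \<open>Since \<open>A\<close> is nonempty, the common factor
    \<open>card A ^ card R\<close> is positive and cancels.\<close>
  ultimately show ?thesis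
    using assms(1,2) by simp
qed

section \<open>Image sizes summed over all subsets of a given size\<close>

lemma card_subsets_of_card_meeting:
  assumes "finite X" "F \<subseteq> X"
  shows "real (card {S \<in> subsets_of_card X m. S \<inter> F \<noteq> {}}) =
    real (card X choose m) - real ((card X - card F) choose m)"
proof -
  have "{S \<in> subsets_of_card X m. S \<inter> F \<noteq> {}} =
      subsets_of_card X m - subsets_of_card (X - F) m"
    using assms(2) by (auto simp: subsets_of_card_def)
  moreover have "subsets_of_card (X - F) m \<subseteq> subsets_of_card X m"
    by (auto simp: subsets_of_card_def)
  ultimately have "real (card {S \<in> subsets_of_card X m. S \<inter> F \<noteq> {}}) =
      real (card (subsets_of_card X m)) - real (card (subsets_of_card (X - F) m))"
    using finite_subsets_of_card[OF assms(1), of m]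
    by (simp add: card_Diff_subset finite_subset card_mono of_nat_diff)
  then show ?thesis
    using assms finite_subset[OF assms(2,1)] by (simp add: card_subsets_of_card card_Diff_subset)
qed

text \<open>Write the image size as a sum of indicators over the values \<open>v\<close> of
  \<open>g\<close> and exchange the sums. A value \<open>v\<close> is hit by \<open>S\<close>
  exactly when \<open>S\<close> meets the fibre over \<open>v\<close>; as all fibres have size
  \<open>k\<close>, every \<open>v\<close> contributes the same number of sets.\<close>

lemma sum_card_image_subsets_of_card:
  assumes "finite X" "\<And>x. x \<in> X \<Longrightarrow> card {y \<in> X. g y = g x} = k"
  shows "(\<Sum>S\<in>subsets_of_card X m. real (card (g ` S))) =
    real (card (g ` X)) * (real (card X choose m) - real ((card X - k) choose m))"
proof -
  let ?M = "subsets_of_card X m"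
  have "(\<Sum>S\<in>?M. real (card (g ` S))) = (\<Sum>S\<in>?M. \<Sum>v\<in>g ` X. of_bool (v \<in> g ` S))"
  proof (rule sum.cong[OF refl])
    fix S assume "S \<in> ?M"
    then have "g ` X \<inter> {v. v \<in> g ` S} = g ` S"
      by (auto simp: subsets_of_card_def)
    then show "real (card (g ` S)) = (\<Sum>v\<in>g ` X. of_bool (v \<in> g ` S))"
      using assms(1) by simp
  qed
  also have "\<dots> = (\<Sum>v\<in>g ` X. \<Sum>S\<in>?M. of_bool (v \<in> g ` S))"
    by (rule sum.swap)
  also have "\<dots> = (\<Sum>v\<in>g ` X. real (card X choose m) - real ((card X - k) choose m))"
  proof (rule sum.cong[OF refl])
    fix v assume "v \<in> g ` X"
    then obtain x where x: "x \<in> X" "v = g x" by blast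
    let ?F = "{y \<in> X. g y = g x}"
    have "?M \<inter> {S. v \<in> g ` S} = {S \<in> ?M. S \<inter> ?F \<noteq> {}}"
      using x by (auto simp: subsets_of_card_def image_iff) (metis subsetD)+
    then have "(\<Sum>S\<in>?M. of_bool (v \<in> g ` S)) = real (card {S \<in> ?M. S \<inter> ?F \<noteq> {}})"
      using finite_subsets_of_card[OF assms(1), of m] by simp
    then show "(\<Sum>S\<in>?M. of_bool (v \<in> g ` S)) =
        real (card X choose m) - real ((card X - k) choose m)"
      using card_subsets_of_card_meeting[OF assms(1), of ?F m] assms(2)[OF x(1)] by simp
  qed
  finally show ?thesis by simp
qed

text \<open>Both sides count pairs of disjoint subsets, of sizes \<open>m\<close> and
  \<open>k\<close>, of an \<open>N\<close>-element set. The identity turns the probability that a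
  random \<open>m\<close>-set avoids a fixed \<open>k\<close>-set into the quotient with the roles
  of \<open>m\<close> and \<open>k\<close> exchanged.\<close>

lemma choose_mult_diff_commute:
  fixes N k m :: nat
  assumes "k \<le> N" "m \<le> N"
  shows "(N choose m) * ((N - m) choose k) = (N choose k) * ((N - k) choose m)"
proof (cases "m + k \<le> N")
  case True
  then show ?thesis
    using choose_mult[of m "m + k" N] choose_mult[of k "m + k" N] binomial_symmetric[of k "m + k"]
    by simp
next
  case False
  \<comment> \<open>No disjoint pair fits: \<open>N - m < k\<close> and \<open>N - k < m\<close>, so
    both sides vanish.\<close>
  then show ?thesis
    using assms by (simp add: binomial_eq_0)
qed

section \<open>Success probabilities and the optimal retrieval rule\<close>

lemma success_prob_uniform_erasure:
  assumes "finite S" "S \<noteq> {}" "S \<subseteq> words A n" "r \<le> n" "uniform_erasure A n r E"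
  shows "success_prob S (pmf_of_set S) E f =
    (\<Sum>R\<in>subsets_of_card {..<n} r. real (card {w \<in> S. f (erase R w) = w})) /
    (real (card S) * real (n choose r))"
proof -
  let ?Rs = "subsets_of_card {..<n} r"
  have fin: "finite ?Rs" and ne: "?Rs \<noteq> {}" and card: "card ?Rs = n choose r"
    using assms(4)
    by (simp_all add: finite_subsets_of_card subsets_of_card_nonempty card_subsets_of_card)
  have prob: "measure_pmf.prob E {e. f (e w) = w} =
      (\<Sum>R\<in>?Rs. of_bool (f (erase R w) = w)) / real (n choose r)" if "w \<in> S" for w
  proof -
    \<comment> \<open>The event depends on \<open>e\<close> only through \<open>e w\<close>, so the
      law of \<open>e w\<close> for each single \<open>w\<close> suffices, whatever the joint law
      over different words.\<close>
    have "measure_pmf.prob E {e. f (e w) = w} =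
        measure_pmf.prob (map_pmf (\<lambda>e. e w) E) {v. f v = w}"
      by (simp add: vimage_def)
    also have "map_pmf (\<lambda>e. e w) E = map_pmf (\<lambda>R. erase R w) (pmf_of_set ?Rs)"
      using assms(3,5) that by (auto simp: uniform_erasure_def)
    also have "measure_pmf.prob \<dots> {v. f v = w} =
        real (card (?Rs \<inter> {R. f (erase R w) = w})) / real (n choose r)"
      using fin ne by (simp add: vimage_def measure_pmf_of_set card)
    finally show ?thesis
      using fin by simp
  qed
  have "success_prob S (pmf_of_set S) E f =
      (\<Sum>w\<in>S. (\<Sum>R\<in>?Rs. of_bool (f (erase R w) = w)) / (real (card S) * real (n choose r)))"
    unfolding success_prob_def using assms(1,2) by (intro sum.cong) (simp_all add: prob)
  also have "\<dots> = (\<Sum>w\<in>S. \<Sum>R\<in>?Rs. of_bool (f (erase R w) = w)) /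
      (real (card S) * real (n choose r))"
    by (simp only: sum_divide_distrib)
  also have "(\<Sum>w\<in>S. \<Sum>R\<in>?Rs. of_bool (f (erase R w) = w)) =
      (\<Sum>R\<in>?Rs. \<Sum>w\<in>S. of_bool (f (erase R w) = w) :: real)"
    by (rule sum.swap)
  also have "\<dots> = (\<Sum>R\<in>?Rs. real (card {w \<in> S. f (erase R w) = w}))"
    using assms(1) by (simp add: Int_def)
  finally show ?thesis .
qed

text \<open>On the retrieved words \<open>f\<close> is a left inverse of \<open>g\<close>, so
  \<open>g\<close> is injective there.\<close>

lemma card_retrieved_le:
  assumes "finite S"
  shows "card {w \<in> S. f (g w) = w} \<le> card (g ` S)"
proof (rule card_inj_on_le[where f = g])
  show "inj_on g {w \<in> S. f (g w) = w}"
    by (rule inj_onI) (metis (mono_tags, lifting) mem_Collect_eq)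
qed (use assms in auto)

lemma ex_rule_retrieving_all_erasures:
  assumes "finite S" "S \<noteq> {}" "S \<subseteq> words A n"
  obtains f where "f \<in> retrieval_rules A n S"
    and "\<And>R. R \<subseteq> {..<n} \<Longrightarrow> card {w \<in> S. f (erase R w) = w} = card (erase R ` S)"
proof -
  \<comment> \<open>\<open>Q v\<close> recovers the erased positions from \<open>v\<close>. The rule
    \<open>f\<close> then picks a word of \<open>S\<close> compatible with \<open>v\<close>; if
    there is none, any word of \<open>S\<close> serves, which keeps \<open>f\<close> a map into
    \<open>S\<close>.\<close>
  define Q where "Q v = {i. i < length v \<and> v ! i = None}" for v :: "'a option list"
  define f where "f v = (if \<exists>w\<in>S. erase (Q v) w = v then SOME w. w \<in> S \<and> erase (Q v) w = v
    else SOME w. w \<in> S)" for v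
  have f_mem: "f v \<in> S" for v
  proof (cases "\<exists>w\<in>S. erase (Q v) w = v")
    case True
    then show ?thesis
      unfolding f_def using someI_ex[of "\<lambda>w. w \<in> S \<and> erase (Q v) w = v"] by auto
  next
    case False
    then show ?thesis
      unfolding f_def using assms(2) by (simp add: some_in_eq)
  qed
  have f_erase: "erase R (f (erase R w)) = erase R w" if "R \<subseteq> {..<n}" "w \<in> S" for R w
  proof -
    have "Q (erase R w) = R"
      unfolding Q_def using that assms(3) by (intro erased_positions_erase) (auto simp: words_def)
    then show ?thesis
      unfolding f_def using that(2)
        someI_ex[of "\<lambda>u. u \<in> S \<and> erase R u = erase R w"] by auto
  qed
  show thesis
  proof
    show "f \<in> retrieval_rules A n S"
      using f_mem by (simp add: retrieval_rules_def)
    fix R :: "nat set" assume R: "R \<subseteq> {..<n}"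
    \<comment> \<open>The chosen word \<open>f (erase R w)\<close> represents
      \<open>erase R w\<close>: erasing it at \<open>R\<close> gives \<open>erase R w\<close> again,
      so \<open>f\<close> retrieves it.\<close>
    have "erase R ` S \<subseteq> erase R ` {w \<in> S. f (erase R w) = w}"
    proof (rule image_subsetI)
      fix w assume "w \<in> S"
      then show "erase R w \<in> erase R ` {w \<in> S. f (erase R w) = w}"
        using f_erase[OF R] f_mem by (intro image_eqI[of _ _ "f (erase R w)"]) auto
    qed
    then have "card (erase R ` S) \<le> card {w \<in> S. f (erase R w) = w}"
      using assms(1) by (intro surj_card_le[where f = "erase R"]) simp_all
    then show "card {w \<in> S. f (erase R w) = w} = card (erase R ` S)"
      using card_retrieved_le[OF assms(1), of f "erase R"] by simp
  qed
qed

text \<open>The bound of \<open>card_retrieved_le\<close>, applied for each \<open>R\<close>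
  separately, limits every rule. The rule \<open>g\<close> that is optimal for all \<open>R\<close>
  simultaneously attains it, and \<open>f\<close> does at least as well as \<open>g\<close>.\<close>

lemma success_prob_max_likelihood_rule:
  assumes "finite S" "S \<noteq> {}" "S \<subseteq> words A n" "r \<le> n" "uniform_erasure A n r E"
    and "max_likelihood_rule A n S (pmf_of_set S) E f"
  shows "success_prob S (pmf_of_set S) E f =
    (\<Sum>R\<in>subsets_of_card {..<n} r. real (card (erase R ` S))) /
    (real (card S) * real (n choose r))"
proof (rule antisym)
  note sp = success_prob_uniform_erasure[OF assms(1-5)]
  show "success_prob S (pmf_of_set S) E f \<le>
      (\<Sum>R\<in>subsets_of_card {..<n} r. real (card (erase R ` S))) /
      (real (card S) * real (n choose r))"
    unfolding sp using card_retrieved_le[OF assms(1)]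
    by (intro divide_right_mono sum_mono) simp_all
  obtain g where g: "g \<in> retrieval_rules A n S"
    "\<And>R. R \<subseteq> {..<n} \<Longrightarrow> card {w \<in> S. g (erase R w) = w} = card (erase R ` S)"
    using ex_rule_retrieving_all_erasures[OF assms(1-3)] by blast
  have "success_prob S (pmf_of_set S) E g =
      (\<Sum>R\<in>subsets_of_card {..<n} r. real (card (erase R ` S))) /
      (real (card S) * real (n choose r))"
    unfolding sp using g(2)
    by (intro arg_cong2[where f = "(/)"] sum.cong) (auto simp: subsets_of_card_def)
  moreover have "success_prob S (pmf_of_set S) E g \<le> success_prob S (pmf_of_set S) E f"
    using assms(6) g(1) by (auto simp: max_likelihood_rule_def is_arg_max_def not_less)
  ultimately show "(\<Sum>R\<in>subsets_of_card {..<n} r. real (card (erase R ` S))) /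
      (real (card S) * real (n choose r)) \<le> success_prob S (pmf_of_set S) E f"
    by simp
qed

section \<open>Expectation of the optimal success probability\<close>

theorem theorem4:
  fixes A :: "'a set" and n r m :: nat
    and E :: "('a list \<Rightarrow> 'a option list) pmf"
    and fstar :: "'a list set \<Rightarrow> 'a option list \<Rightarrow> 'a list"
  assumes "finite A" and "card A \<ge> 2"
    and "n \<ge> 1" and "r \<le> n" and "1 \<le> m" and "m \<le> card A ^ n"
    and "uniform_erasure A n r E"
    and "\<And>S. S \<in> subsets_of_card (words A n) m \<Longrightarrow>
           max_likelihood_rule A n S (pmf_of_set S) E (fstar S)"
  shows "measure_pmf.expectation (pmf_of_set (subsets_of_card (words A n) m))
           (\<lambda>S. success_prob S (pmf_of_set S) E (fstar S))
         = real (card A) ^ (n - r) / real m *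
           (1 - real ((card A ^ n - m) choose (card A ^ r))
                / real ((card A ^ n) choose (card A ^ r)))"
proof -
  let ?W = "words A n" and ?Rs = "subsets_of_card {..<n} r" and ?q = "card A"
  let ?M = "subsets_of_card ?W m"
  have finW: "finite ?W" and cardW: "card ?W = ?q ^ n"
    using assms(1) by (simp_all add: finite_words card_words)
  have M: "finite ?M" "?M \<noteq> {}" "card ?M = ?q ^ n choose m"
    using finW assms(6)
    by (simp_all add: finite_subsets_of_card subsets_of_card_nonempty card_subsets_of_card cardW)
  have card_Rs: "card ?Rs = n choose r"
    by (simp add: card_subsets_of_card)
  \<comment> \<open>The number of \<open>m\<close>-element sets of words meeting a fixed fibre,
    which has \<open>?q ^ r\<close> elements.\<close>
  define D where "D = real (?q ^ n choose m) - real ((?q ^ n - ?q ^ r) choose m)"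
  have sp: "success_prob S (pmf_of_set S) E (fstar S) =
      (\<Sum>R\<in>?Rs. real (card (erase R ` S))) / (real m * real (n choose r))" if "S \<in> ?M" for S
  proof -
    have S: "S \<subseteq> ?W" "card S = m"
      using that by (auto simp: subsets_of_card_def)
    then have "finite S" "S \<noteq> {}"
      using finW assms(5) finite_subset by auto
    with S show ?thesis
      using success_prob_max_likelihood_rule[OF _ _ S(1) assms(4,7) assms(8)[OF that]] by simp
  qed
  \<comment> \<open>The value depends on \<open>R\<close> only through \<open>card R = r\<close>;
    the sum over \<open>R\<close> therefore yields a factor \<open>n choose r\<close>, which cancels
    the normalisation of the uniform choice of \<open>R\<close>.\<close>
  have inner: "(\<Sum>S\<in>?M. real (card (erase R ` S))) = real ?q ^ (n - r) * D" if "R \<in> ?Rs" for R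
  proof -
    have R: "R \<subseteq> {..<n}" "card R = r"
      using that by (auto simp: subsets_of_card_def)
    have "A \<noteq> {}" using assms(2) by auto
    then show ?thesis
      using sum_card_image_subsets_of_card[OF finW card_erase_fibre[OF assms(1) R(1)]]
        card_erase_image[OF assms(1) _ R(1)]
      by (simp add: R(2) cardW D_def)
  qed
  have "measure_pmf.expectation (pmf_of_set ?M) (\<lambda>S. success_prob S (pmf_of_set S) E (fstar S)) =
      (\<Sum>S\<in>?M. success_prob S (pmf_of_set S) E (fstar S)) / real (?q ^ n choose m)"
    using M by (simp add: integral_pmf_of_set)
  also have "\<dots> = (\<Sum>S\<in>?M. \<Sum>R\<in>?Rs. real (card (erase R ` S))) /
      (real m * real (n choose r)) / real (?q ^ n choose m)"
    by (simp add: sp sum_divide_distrib)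
  also have "(\<Sum>S\<in>?M. \<Sum>R\<in>?Rs. real (card (erase R ` S))) =
      (\<Sum>R\<in>?Rs. \<Sum>S\<in>?M. real (card (erase R ` S)))"
    by (rule sum.swap)
  also have "\<dots> = real (n choose r) * (real ?q ^ (n - r) * D)"
    by (simp add: inner card_Rs)
  also have "\<dots> / (real m * real (n choose r)) / real (?q ^ n choose m) =
      real ?q ^ (n - r) / real m * (D / real (?q ^ n choose m))"
    using assms(4) by simp
  also have "D / real (?q ^ n choose m) =
      1 - real ((?q ^ n - m) choose (?q ^ r)) / real ((?q ^ n) choose (?q ^ r))"
  proof -
    \<comment> \<open>This and \<open>m \<le> ?q ^ n\<close> make both denominators nonzero, so the
      exchange identity can be divided through.\<close>
    have "?q ^ r \<le> ?q ^ n"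
      using assms(2,4) by (intro power_increasing) auto
    then have "real (?q ^ n choose m) * real ((?q ^ n - m) choose (?q ^ r)) =
        real (?q ^ n choose (?q ^ r)) * real ((?q ^ n - ?q ^ r) choose m)"
      and "?q ^ n choose (?q ^ r) \<noteq> 0" and "?q ^ n choose m \<noteq> 0"
      using choose_mult_diff_commute[of "?q ^ r" "?q ^ n" m] assms(6)
      by (simp_all flip: of_nat_mult add: not_less)
    then show ?thesis
      by (simp add: D_def field_simps)
  qed
  finally show ?thesis .
qed

end
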